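(* Let $n\geq 2$ and $m\geq 1$. Then there are $\phi,\psi\in H_n$ such that $H_m$ is isomorphic, as a lattice, to the interval $[\phi,\psi]=\{\rho\in H_n\mid \phi\leq\rho\leq\psi\}$. In addition, the isomorphism from $[\phi,\psi]$ to $H_m$ can be extended to a surjective lattice-homomorphism from $H_n$ to $H_m$.
   Context: For $n\in\mathbb{N}$, $F_n$ is the set of propositional formulas in the variables $x_1,\ldots,x_n$, and $H_n$ is the intuitionistic Lindenbaum algebra, i.e. $F_n$ modulo intuitionistic logical equivalence; equivalently, $H_n$ is the free Heyting algebra on $n$ generators, with its usual order $\leq$ (so $[\rho]\le[\rho']$ iff $\rho\vdash\rho'$ intuitionistically). A lattice-homomorphism is a map preserving $\wedge$ and $\vee$; a lattice isomorphism is a bijective lattice-homomorphism. *)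

theory Defs
  imports "HOL-Algebra.Lattice"
begin

datatype (vars: 'a) form =
    Bot
  | Var 'a
  | And "'a form" "'a form"
  | Or "'a form" "'a form"
  | Imp "'a form" "'a form"

text \<open>Natural deduction for intuitionistic propositional logic. Negation is \<open>Imp p Bot\<close> and
  truth is \<open>Imp Bot Bot\<close>.\<close>

inductive derives :: "'a form set \<Rightarrow> 'a form \<Rightarrow> bool" (infix \<open>\<turnstile>\<close> 50) where
  Ax: "p \<in> \<Gamma> \<Longrightarrow> \<Gamma> \<turnstile> p"
| BotE: "\<Gamma> \<turnstile> Bot \<Longrightarrow> \<Gamma> \<turnstile> p"
| AndI: "\<Gamma> \<turnstile> p \<Longrightarrow> \<Gamma> \<turnstile> q \<Longrightarrow> \<Gamma> \<turnstile> And p q"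
| AndE1: "\<Gamma> \<turnstile> And p q \<Longrightarrow> \<Gamma> \<turnstile> p"
| AndE2: "\<Gamma> \<turnstile> And p q \<Longrightarrow> \<Gamma> \<turnstile> q"
| OrI1: "\<Gamma> \<turnstile> p \<Longrightarrow> \<Gamma> \<turnstile> Or p q"
| OrI2: "\<Gamma> \<turnstile> q \<Longrightarrow> \<Gamma> \<turnstile> Or p q"
| OrE: "\<Gamma> \<turnstile> Or p q \<Longrightarrow> insert p \<Gamma> \<turnstile> r \<Longrightarrow> insert q \<Gamma> \<turnstile> r \<Longrightarrow> \<Gamma> \<turnstile> r"
| ImpI: "insert p \<Gamma> \<turnstile> q \<Longrightarrow> \<Gamma> \<turnstile> Imp p q"
| ImpE: "\<Gamma> \<turnstile> Imp p q \<Longrightarrow> \<Gamma> \<turnstile> p \<Longrightarrow> \<Gamma> \<turnstile> q"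

definition F :: "nat \<Rightarrow> nat form set" where
  "F n = {p. vars p \<subseteq> {1..n}}"

definition int_equiv :: "nat \<Rightarrow> (nat form \<times> nat form) set" where
  "int_equiv n = {(p, q). p \<in> F n \<and> q \<in> F n \<and> {p} \<turnstile> q \<and> {q} \<turnstile> p}"

text \<open>The Lindenbaum algebra as an ordered set whose elements are equivalence classes of formulas.
  Its lattice operations are those of the order; \<open>meet_H\<close> and \<open>join_H\<close> below identify them with
  conjunction and disjunction of representatives.\<close>

definition H :: "nat \<Rightarrow> nat form set gorder" where
  "H n = \<lparr>carrier = F n // int_equiv n, eq = (=), le = (\<lambda>A B. \<exists>p\<in>A. \<exists>q\<in>B. {p} \<turnstile> q)\<rparr>"

definition lattice_hom :: "('a, 'c) gorder_scheme \<Rightarrow> ('b, 'd) gorder_scheme \<Rightarrow> ('a \<Rightarrow> 'b) set" where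
  "lattice_hom X Y = {f \<in> carrier X \<rightarrow> carrier Y. meet_pres X Y f \<and> join_pres X Y f}"

definition lattice_iso :: "('a, 'c) gorder_scheme \<Rightarrow> ('b, 'd) gorder_scheme \<Rightarrow> ('a \<Rightarrow> 'b) set" where
  "lattice_iso X Y = {f \<in> lattice_hom X Y. bij_betw f (carrier X) (carrier Y)}"

text \<open>The interval as a lattice in its own right; \<open>interval_meet_join\<close> below shows that its
  operations are the restrictions of those of the ambient lattice.\<close>

abbreviation interval :: "('a, 'c) gorder_scheme \<Rightarrow> 'a \<Rightarrow> 'a \<Rightarrow> ('a, 'c) gorder_scheme" where
  "interval L a b \<equiv> L\<lparr>carrier := \<lbrace>a..b\<rbrace>\<^bsub>L\<^esub>\<rparr>"


lemma derives_mono: "\<Gamma> \<turnstile> p \<Longrightarrow> \<Gamma> \<subseteq> \<Delta> \<Longrightarrow> \<Delta> \<turnstile> p"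
proof (induction arbitrary: \<Delta> rule: derives.induct)
  case (Ax p \<Gamma>)
  then show ?case by (simp add: derives.Ax subsetD)
next
  case (OrE \<Gamma> p q r)
  show ?case
  proof (rule derives.OrE)
    show "\<Delta> \<turnstile> Or p q" by (rule OrE.IH(1)[OF OrE.prems])
    show "insert p \<Delta> \<turnstile> r" by (rule OrE.IH(2)) (rule insert_mono[OF OrE.prems])
    show "insert q \<Delta> \<turnstile> r" by (rule OrE.IH(3)) (rule insert_mono[OF OrE.prems])
  qed
next
  case (ImpI p \<Gamma> q)
  show ?case
    by (rule derives.ImpI, rule ImpI.IH, rule insert_mono, rule ImpI.prems)
next
  case BotE
  then show ?case by (simp add: derives.BotE)
next
  case AndI
  then show ?case by (simp add: derives.AndI)
next
  case (AndE1 \<Gamma> p q)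
  show ?case by (rule derives.AndE1[OF AndE1.IH[OF AndE1.prems]])
next
  case (AndE2 \<Gamma> p q)
  show ?case by (rule derives.AndE2[OF AndE2.IH[OF AndE2.prems]])
next
  case OrI1
  then show ?case by (simp add: derives.OrI1)
next
  case OrI2
  then show ?case by (simp add: derives.OrI2)
next
  case (ImpE \<Gamma> p q)
  show ?case by (rule derives.ImpE[OF ImpE.IH[OF ImpE.prems]])
qed

lemma derives_cut: "\<Gamma> \<turnstile> p \<Longrightarrow> insert p \<Gamma> \<turnstile> q \<Longrightarrow> \<Gamma> \<turnstile> q"
  by (rule derives.ImpE[OF derives.ImpI])

lemma derives_trans: "{p} \<turnstile> q \<Longrightarrow> {q} \<turnstile> r \<Longrightarrow> {p} \<turnstile> r"
  by (rule derives_cut[of _ q]) (simp_all add: derives_mono[of "{q}"])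

lemma F_simps [simp]:
  "Bot \<in> F n" "Var i \<in> F n \<longleftrightarrow> 1 \<le> i \<and> i \<le> n"
  "And p q \<in> F n \<longleftrightarrow> p \<in> F n \<and> q \<in> F n" "Or p q \<in> F n \<longleftrightarrow> p \<in> F n \<and> q \<in> F n"
  "Imp p q \<in> F n \<longleftrightarrow> p \<in> F n \<and> q \<in> F n"
  by (auto simp: F_def)

lemma equiv_int_equiv: "equiv (F n) (int_equiv n)"
  by (rule equivI)
    (auto simp: int_equiv_def refl_on_def sym_def trans_def intro: derives.Ax derives_trans)

lemma carrier_H: "carrier (H n) = F n // int_equiv n"
  by (simp add: H_def)

lemma class_in_H: "p \<in> F n \<Longrightarrow> int_equiv n `` {p} \<in> carrier (H n)"
  by (simp add: carrier_H quotientI)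

lemma H_cases:
  assumes "A \<in> carrier (H n)"
  obtains p where "p \<in> F n" "A = int_equiv n `` {p}"
  using assms by (auto simp: carrier_H elim: quotientE)

lemma le_H:
  assumes "p \<in> F n" "q \<in> F n"
  shows "int_equiv n `` {p} \<sqsubseteq>\<^bsub>H n\<^esub> int_equiv n `` {q} \<longleftrightarrow> {p} \<turnstile> q"
  using assms by (auto simp: H_def int_equiv_def intro: derives_trans derives.Ax)

lemma partial_order_H: "partial_order (H n)"
proof
  fix A B assume "A \<in> carrier (H n)" "B \<in> carrier (H n)" "A \<sqsubseteq>\<^bsub>H n\<^esub> B" "B \<sqsubseteq>\<^bsub>H n\<^esub> A"
  then have "A = B"
  proof (elim H_cases)
    fix p q assume pq: "p \<in> F n" "q \<in> F n" "A = int_equiv n `` {p}" "B = int_equiv n `` {q}"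
      and le: "A \<sqsubseteq>\<^bsub>H n\<^esub> B" "B \<sqsubseteq>\<^bsub>H n\<^esub> A"
    have "{p} \<turnstile> q" "{q} \<turnstile> p"
      using pq le by (simp_all add: le_H)
    then have "(p, q) \<in> int_equiv n"
      using pq by (simp add: int_equiv_def)
    then show "A = B"
      using pq equiv_class_eq[OF equiv_int_equiv] by blast
  qed
  then show "A .=\<^bsub>H n\<^esub> B" by (simp add: H_def)
next
  fix A B C assume "A \<in> carrier (H n)" "B \<in> carrier (H n)" "C \<in> carrier (H n)"
    "A \<sqsubseteq>\<^bsub>H n\<^esub> B" "B \<sqsubseteq>\<^bsub>H n\<^esub> C"
  then show "A \<sqsubseteq>\<^bsub>H n\<^esub> C"
    by (elim H_cases) (simp only: le_H, rule derives_trans)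
next
  fix A assume "A \<in> carrier (H n)"
  then show "A \<sqsubseteq>\<^bsub>H n\<^esub> A"
    by (elim H_cases) (simp add: le_H derives.Ax)
qed (auto simp: H_def)

lemma greatest_And:
  assumes "p \<in> F n" "q \<in> F n"
  shows "greatest (H n) (int_equiv n `` {And p q})
    (Lower (H n) {int_equiv n `` {p}, int_equiv n `` {q}})"
proof (rule greatest_LowerI)
  fix A assume "A \<in> Lower (H n) {int_equiv n `` {p}, int_equiv n `` {q}}"
  then obtain r where "r \<in> F n" "A = int_equiv n `` {r}" "{r} \<turnstile> p" "{r} \<turnstile> q"
    using assms by (auto simp: Lower_def le_H class_in_H elim!: H_cases)
  then show "A \<sqsubseteq>\<^bsub>H n\<^esub> int_equiv n `` {And p q}"
    using assms by (simp add: le_H derives.AndI)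
next
  have "{And p q} \<turnstile> p" "{And p q} \<turnstile> q"
    by (rule derives.AndE1 derives.AndE2, rule derives.Ax, simp)+
  then show "x \<in> {int_equiv n `` {p}, int_equiv n `` {q}} \<Longrightarrow>
    int_equiv n `` {And p q} \<sqsubseteq>\<^bsub>H n\<^esub> x" for x
    using assms by (auto simp only: insert_iff empty_iff le_H F_simps)
qed (use assms in \<open>simp_all add: class_in_H\<close>)

lemma least_Or:
  assumes "p \<in> F n" "q \<in> F n"
  shows "least (H n) (int_equiv n `` {Or p q})
    (Upper (H n) {int_equiv n `` {p}, int_equiv n `` {q}})"
proof (rule least_UpperI)
  fix A assume "A \<in> Upper (H n) {int_equiv n `` {p}, int_equiv n `` {q}}"
  then obtain r where r: "r \<in> F n" "A = int_equiv n `` {r}" "{p} \<turnstile> r" "{q} \<turnstile> r"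
    using assms by (auto simp: Upper_def le_H class_in_H elim!: H_cases)
  have "{Or p q} \<turnstile> r"
  proof (rule derives.OrE)
    show "{Or p q} \<turnstile> Or p q" by (simp add: derives.Ax)
    show "insert p {Or p q} \<turnstile> r" by (rule derives_mono[OF r(3)]) simp
    show "insert q {Or p q} \<turnstile> r" by (rule derives_mono[OF r(4)]) simp
  qed
  then show "int_equiv n `` {Or p q} \<sqsubseteq>\<^bsub>H n\<^esub> A"
    using assms r by (simp add: le_H)
next
  have "{p} \<turnstile> Or p q" "{q} \<turnstile> Or p q"
    by (simp_all add: derives.Ax derives.OrI1 derives.OrI2)
  then show "x \<in> {int_equiv n `` {p}, int_equiv n `` {q}} \<Longrightarrow>
    x \<sqsubseteq>\<^bsub>H n\<^esub> int_equiv n `` {Or p q}" for x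
    using assms by (auto simp only: insert_iff empty_iff le_H F_simps)
qed (use assms in \<open>simp_all add: class_in_H\<close>)

lemma lattice_H: "lattice (H n)"
proof -
  interpret partial_order "H n" by (rule partial_order_H)
  show ?thesis
    by unfold_locales (auto elim!: H_cases intro: greatest_And least_Or)
qed

lemma meet_H:
  assumes "p \<in> F n" "q \<in> F n"
  shows "int_equiv n `` {p} \<sqinter>\<^bsub>H n\<^esub> int_equiv n `` {q} = int_equiv n `` {And p q}"
proof -
  interpret partial_order "H n" by (rule partial_order_H)
  show ?thesis
    unfolding meet_def Lattice.inf_def
    by (rule some_equality) (use greatest_And[OF assms] greatest_unique in blast)+
qed

lemma join_H:
  assumes "p \<in> F n" "q \<in> F n"
  shows "int_equiv n `` {p} \<squnion>\<^bsub>H n\<^esub> int_equiv n `` {q} = int_equiv n `` {Or p q}"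
proof -
  interpret partial_order "H n" by (rule partial_order_H)
  show ?thesis
    unfolding join_def Lattice.sup_def
    by (rule some_equality) (use least_Or[OF assms] least_unique in blast)+
qed

lemma partial_order_interval:
  assumes "partial_order L"
  shows "partial_order (interval L a b)"
proof -
  interpret partial_order L by fact
  have "weak_partial_order (interval L a b)"
    by (rule weak_partial_order_subset) (use at_least_at_most_closed weak_partial_order_axioms in auto)
  then show ?thesis
    by (simp add: eq_is_equal partial_order.intro partial_order_axioms.intro)
qed

lemma interval_bounds:
  assumes "lattice L" "a \<in> carrier L" "b \<in> carrier L" "x \<in> \<lbrace>a..b\<rbrace>\<^bsub>L\<^esub>" "y \<in> \<lbrace>a..b\<rbrace>\<^bsub>L\<^esub>"
  shows "greatest (interval L a b) (x \<sqinter>\<^bsub>L\<^esub> y) (Lower (interval L a b) {x, y})"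
    and "least (interval L a b) (x \<squnion>\<^bsub>L\<^esub> y) (Upper (interval L a b) {x, y})"
proof -
  interpret lattice L by fact
  have xy: "x \<in> carrier L" "y \<in> carrier L" "a \<sqsubseteq>\<^bsub>L\<^esub> x" "a \<sqsubseteq>\<^bsub>L\<^esub> y" "x \<sqsubseteq>\<^bsub>L\<^esub> b" "y \<sqsubseteq>\<^bsub>L\<^esub> b"
    using assms by (auto simp: at_least_at_most_def)
  have m: "x \<sqinter>\<^bsub>L\<^esub> y \<in> \<lbrace>a..b\<rbrace>\<^bsub>L\<^esub>"
    using xy assms(2,3) meet_left[of x y] meet_le[OF xy(3,4)] le_trans[of "x \<sqinter>\<^bsub>L\<^esub> y" x b]
    by (auto simp: at_least_at_most_def)
  have j: "x \<squnion>\<^bsub>L\<^esub> y \<in> \<lbrace>a..b\<rbrace>\<^bsub>L\<^esub>"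
    using xy assms(2,3) join_left[of x y] join_le[OF xy(5,6)] le_trans[of a x "x \<squnion>\<^bsub>L\<^esub> y"]
    by (auto simp: at_least_at_most_def)
  show "greatest (interval L a b) (x \<sqinter>\<^bsub>L\<^esub> y) (Lower (interval L a b) {x, y})"
  proof (rule greatest_LowerI)
    fix z assume "z \<in> Lower (interval L a b) {x, y}"
    then show "z \<sqsubseteq>\<^bsub>interval L a b\<^esub> x \<sqinter>\<^bsub>L\<^esub> y"
      using xy assms(4,5) by (auto simp: Lower_def at_least_at_most_def intro: meet_le)
  qed (use m xy assms(4,5) meet_left meet_right in auto)
  show "least (interval L a b) (x \<squnion>\<^bsub>L\<^esub> y) (Upper (interval L a b) {x, y})"
  proof (rule least_UpperI)
    fix z assume "z \<in> Upper (interval L a b) {x, y}"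
    then show "x \<squnion>\<^bsub>L\<^esub> y \<sqsubseteq>\<^bsub>interval L a b\<^esub> z"
      using xy assms(4,5) by (auto simp: Upper_def at_least_at_most_def intro: join_le)
  qed (use j xy assms(4,5) join_left join_right in auto)
qed

lemma lattice_interval:
  assumes "lattice L" "a \<in> carrier L" "b \<in> carrier L"
  shows "lattice (interval L a b)"
proof -
  interpret L: lattice L by fact
  interpret partial_order "interval L a b"
    by (rule partial_order_interval) (rule L.partial_order_axioms)
  show ?thesis
    by unfold_locales (simp, rule exI, rule interval_bounds[OF assms], assumption+)+
qed

lemma interval_meet_join:
  assumes "lattice L" "a \<in> carrier L" "b \<in> carrier L" "x \<in> \<lbrace>a..b\<rbrace>\<^bsub>L\<^esub>" "y \<in> \<lbrace>a..b\<rbrace>\<^bsub>L\<^esub>"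
  shows "x \<sqinter>\<^bsub>interval L a b\<^esub> y = x \<sqinter>\<^bsub>L\<^esub> y" "x \<squnion>\<^bsub>interval L a b\<^esub> y = x \<squnion>\<^bsub>L\<^esub> y"
proof -
  interpret I: lattice "interval L a b" by (rule lattice_interval) fact+
  show "x \<sqinter>\<^bsub>interval L a b\<^esub> y = x \<sqinter>\<^bsub>L\<^esub> y"
    unfolding meet_def[of "interval L a b"] Lattice.inf_def[of "interval L a b"]
    by (rule some_equality) (use interval_bounds(1)[OF assms] I.greatest_unique in blast)+
  show "x \<squnion>\<^bsub>interval L a b\<^esub> y = x \<squnion>\<^bsub>L\<^esub> y"
    unfolding join_def[of "interval L a b"] Lattice.sup_def[of "interval L a b"]
    by (rule some_equality) (use interval_bounds(2)[OF assms] I.least_unique in blast)+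
qed

end

theory Submission
  imports Defs
begin

text \<open>Kripke models guide the proof, although every step is carried out on formulas. Write
  \<open>x\<close>, \<open>y\<close> for \<open>x\<^sub>1\<close>, \<open>x\<^sub>2\<close>. It is enough to change the number of variables by one at a time,
  because an interval of an interval is an interval.

  From \<open>n + 1\<close> down to \<open>n\<close>, the interval from \<open>Bot\<close> to \<open>Neg x\<^sub>n\<^sub>+\<^sub>1\<close> serves: below \<open>Neg x\<^sub>n\<^sub>+\<^sub>1\<close> the last
  variable is equivalent to \<open>Bot\<close> and can be substituted away.

  The idea lies in the step from \<open>n\<close> up to \<open>n + 1\<close> variables for \<open>n \<ge> 2\<close>. Let \<open>\<C>\<close> consist of four maximal
  worlds, the corners, at which \<open>x\<close> and \<open>y\<close> take the four classical pairs of values while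
  \<open>x\<^sub>3, \<dots>, x\<^sub>n\<close> are true. Given a Kripke model \<open>K\<close> for \<open>n + 1\<close> variables, put \<open>K\<close> below \<open>\<C>\<close> as follows.
  At all worlds of \<open>K\<close> make \<open>x\<close> and \<open>y\<close> false, and let \<open>x\<^sub>3, \<dots>, x\<^sub>n\<close> keep their values.
  Every world of \<open>K\<close> sees the corner where \<open>x\<close> and \<open>y\<close> are both true, and it sees the other three
  corners exactly where the variables \<open>x\<^sub>1\<close>, \<open>x\<^sub>2\<close>, \<open>x\<^sub>n\<^sub>+\<^sub>1\<close> of \<open>K\<close> fail. So three variables of \<open>K\<close> are
  encoded by visibility of corners, and two variables suffice to set up the corners. The formula
  \<open>decided n\<close> is the lower end of the interval; it holds at the corners and nowhere in \<open>K\<close>. The upper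
  end \<open>framed n\<close> holds at a world that does not force \<open>decided n\<close> only if
  this world makes \<open>x\<close> and \<open>y\<close> false and sees the corner where both are true, as worlds of \<open>K\<close> do.

  Two translations make this precise. The formula \<open>trace n p\<close> expresses in the variables of \<open>K\<close> that
  \<open>p\<close> is forced in the enlarged model; the only clause with content is implication, which has to
  be respected at the visible corners too. In the opposite direction, \<open>realize n\<close> sends each variable
  of \<open>K\<close> to its encoding and \<open>Bot\<close> to \<open>decided n\<close>. Both preserve derivability (\<open>trace_derives\<close>,
  \<open>realize_derives\<close>), \<open>trace\<close> inverts \<open>realize\<close> (\<open>trace_realize\<close>), and under the hypothesis
  \<open>framed n\<close> the composite in the other order adds the disjunct \<open>decided n\<close> (\<open>realize_trace\<close>), which
  is no change inside the interval. Moreover \<open>trace\<close> is defined on all formulas and commutes with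
  conjunction and disjunction; therefore the isomorphism comes with its extension to the whole
  algebra.\<close>

section \<open>Invertible rules of natural deduction\<close>

abbreviation Neg :: "'a form \<Rightarrow> 'a form" where
  "Neg p \<equiv> Imp p Bot"

lemma derives_weaken: "\<Gamma> \<turnstile> p \<Longrightarrow> insert q \<Gamma> \<turnstile> p"
  by (erule derives_mono) blast

lemma derives_And_iff: "\<Gamma> \<turnstile> And p q \<longleftrightarrow> \<Gamma> \<turnstile> p \<and> \<Gamma> \<turnstile> q"
  by (blast intro: derives.AndI derives.AndE1 derives.AndE2)

lemma derives_Imp_iff: "\<Gamma> \<turnstile> Imp p q \<longleftrightarrow> insert p \<Gamma> \<turnstile> q"
proof
  assume "\<Gamma> \<turnstile> Imp p q"
  then have "insert p \<Gamma> \<turnstile> Imp p q" by (rule derives_weaken)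
  then show "insert p \<Gamma> \<turnstile> q" by (rule derives.ImpE) (simp add: derives.Ax)
qed (rule derives.ImpI)

lemma derives_from_Bot: "insert Bot \<Gamma> \<turnstile> p"
  by (rule derives.BotE) (simp add: derives.Ax)

lemma derives_from_And: "insert (And p q) \<Gamma> \<turnstile> r \<longleftrightarrow> insert p (insert q \<Gamma>) \<turnstile> r"
proof -
  have "\<Gamma> \<turnstile> Imp (And p q) r \<longleftrightarrow> \<Gamma> \<turnstile> Imp q (Imp p r)"
  proof
    assume "\<Gamma> \<turnstile> Imp (And p q) r"
    then have "insert p (insert q \<Gamma>) \<turnstile> Imp (And p q) r"
      by (intro derives_weaken)
    moreover have "insert p (insert q \<Gamma>) \<turnstile> And p q"
      by (simp add: derives_And_iff derives.Ax)
    ultimately show "\<Gamma> \<turnstile> Imp q (Imp p r)"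
      unfolding derives_Imp_iff[of \<Gamma> q] derives_Imp_iff[of _ p] by (rule derives.ImpE)
  next
    assume "\<Gamma> \<turnstile> Imp q (Imp p r)"
    then have "insert (And p q) \<Gamma> \<turnstile> Imp q (Imp p r)"
      by (rule derives_weaken)
    moreover have "insert (And p q) \<Gamma> \<turnstile> And p q"
      by (simp add: derives.Ax)
    ultimately show "\<Gamma> \<turnstile> Imp (And p q) r"
      unfolding derives_Imp_iff[of \<Gamma> "And p q"] derives_And_iff by (blast intro: derives.ImpE)
  qed
  then show ?thesis by (simp add: derives_Imp_iff)
qed

lemma derives_from_Or: "insert (Or p q) \<Gamma> \<turnstile> r \<longleftrightarrow> insert p \<Gamma> \<turnstile> r \<and> insert q \<Gamma> \<turnstile> r"
proof
  assume *: "insert (Or p q) \<Gamma> \<turnstile> r"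
  have "insert a \<Gamma> \<turnstile> r" if "insert a \<Gamma> \<turnstile> Or p q" for a
    using that by (rule derives_cut) (rule derives_mono[OF *], blast)
  then show "insert p \<Gamma> \<turnstile> r \<and> insert q \<Gamma> \<turnstile> r"
    by (simp add: derives.OrI1 derives.OrI2 derives.Ax)
next
  assume *: "insert p \<Gamma> \<turnstile> r \<and> insert q \<Gamma> \<turnstile> r"
  have "insert (Or p q) \<Gamma> \<turnstile> Or p q" by (simp add: derives.Ax)
  then show "insert (Or p q) \<Gamma> \<turnstile> r"
    by (rule derives.OrE) (use * in \<open>blast intro: derives_mono\<close>)+
qed

lemmas derives_invertible =
  derives_And_iff derives_Imp_iff derives_from_Bot derives_from_And derives_from_Or

lemma derives_conj_iff: "\<Gamma> \<turnstile> foldr And ps q \<longleftrightarrow> (\<forall>p\<in>set ps. \<Gamma> \<turnstile> p) \<and> \<Gamma> \<turnstile> q"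
  by (induction ps) (auto simp: derives_And_iff)

lemma derives_weaken_under: "insert p \<Gamma> \<turnstile> r \<Longrightarrow> insert p (insert q \<Gamma>) \<turnstile> r"
  by (erule derives_mono) blast

lemma derives_mp: "insert p \<Gamma> \<turnstile> q \<Longrightarrow> \<Gamma> \<subseteq> \<Delta> \<Longrightarrow> \<Delta> \<turnstile> p \<Longrightarrow> \<Delta> \<turnstile> q"
  by (rule derives_cut[of \<Delta> p]) (blast intro: derives_mono)+

lemma derives_Or_And:
  assumes "\<Gamma> \<turnstile> Or p r" "\<Gamma> \<turnstile> Or q r"
  shows "\<Gamma> \<turnstile> Or (And p q) r"
proof (rule derives.OrE[OF assms(1)])
  have "insert q (insert p \<Gamma>) \<turnstile> Or (And p q) r"
    by (rule derives.OrI1) (simp add: derives_And_iff derives.Ax)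
  moreover have "insert r \<Delta> \<turnstile> Or (And p q) r" for \<Delta>
    by (rule derives.OrI2) (simp add: derives.Ax)
  ultimately show "insert p \<Gamma> \<turnstile> Or (And p q) r" "insert r \<Gamma> \<turnstile> Or (And p q) r"
    using derives.OrE[OF derives_weaken[OF assms(2)]] by blast+
qed

text \<open>Equivalence under hypotheses is a congruence, so an equivalence between two translations of
  a formula need only be examined at its variables and at clauses that do not commute with a
  connective.\<close>

definition equiv_under :: "'a form set \<Rightarrow> 'a form \<Rightarrow> 'a form \<Rightarrow> bool" where
  "equiv_under \<Gamma> p q \<longleftrightarrow> insert p \<Gamma> \<turnstile> q \<and> insert q \<Gamma> \<turnstile> p"

lemma equiv_under_refl: "equiv_under \<Gamma> p p"
  by (simp add: equiv_under_def derives.Ax)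

lemma equiv_under_And:
  assumes "equiv_under \<Gamma> p p'" "equiv_under \<Gamma> q q'"
  shows "equiv_under \<Gamma> (And p q) (And p' q')"
  using assms unfolding equiv_under_def derives_And_iff derives_from_And
  by (blast intro: derives_mono)

lemma equiv_under_Or:
  assumes "equiv_under \<Gamma> p p'" "equiv_under \<Gamma> q q'"
  shows "equiv_under \<Gamma> (Or p q) (Or p' q')"
  using assms unfolding equiv_under_def derives_from_Or
  by (blast intro: derives.OrI1 derives.OrI2)

lemma derives_Imp_mono:
  assumes "insert p' \<Gamma> \<turnstile> p" "insert q \<Gamma> \<turnstile> q'"
  shows "insert (Imp p q) \<Gamma> \<turnstile> Imp p' q'"
  unfolding derives_Imp_iff
proof (rule derives_mp[OF assms(2)])
  have "insert p' (insert (Imp p q) \<Gamma>) \<turnstile> p"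
    by (rule derives_mono[OF assms(1)]) blast
  then show "insert p' (insert (Imp p q) \<Gamma>) \<turnstile> q"
    by (rule derives.ImpE[rotated]) (simp add: derives.Ax)
qed blast

lemma equiv_under_Imp:
  assumes "equiv_under \<Gamma> p p'" "equiv_under \<Gamma> q q'"
  shows "equiv_under \<Gamma> (Imp p q) (Imp p' q')"
  using assms unfolding equiv_under_def by (blast intro: derives_Imp_mono)

primrec holds :: "('a \<Rightarrow> bool) \<Rightarrow> 'a form \<Rightarrow> bool" where
  "holds v Bot \<longleftrightarrow> False"
| "holds v (Var i) \<longleftrightarrow> v i"
| "holds v (And p q) \<longleftrightarrow> holds v p \<and> holds v q"
| "holds v (Or p q) \<longleftrightarrow> holds v p \<or> holds v q"
| "holds v (Imp p q) \<longleftrightarrow> (holds v p \<longrightarrow> holds v q)"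

text \<open>Two-valued soundness: a classical valuation is a Kripke model with a single world, such as a
  maximal world of a larger model.\<close>

lemma derives_imp_holds: "\<Gamma> \<turnstile> p \<Longrightarrow> \<forall>q\<in>\<Gamma>. holds v q \<Longrightarrow> holds v p"
  by (induction rule: derives.induct) auto

section \<open>Intervals presented by formulas\<close>

text \<open>The data of an order isomorphism between an interval of \<open>H n\<close> and \<open>H m\<close>, stated on
  representatives so that it can be composed and checked without quotients. The map \<open>T\<close> lives on all
  of \<open>F n\<close>, not only on the interval, because the isomorphism has to extend. For this
  reason its compatibility with conjunction and disjunction is required: an order
  isomorphism on the interval would say nothing about the values of \<open>T\<close> outside it.\<close>

locale interval_retract =
  fixes n m :: nat and \<phi> \<psi> :: "nat form" and T s :: "nat form \<Rightarrow> nat form"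
  assumes bounds: "\<phi> \<in> F n" "\<psi> \<in> F n"
    and T_F: "p \<in> F n \<Longrightarrow> T p \<in> F m"
    and s_F: "a \<in> F m \<Longrightarrow> s a \<in> F n"
    and T_mono: "\<lbrakk>p \<in> F n; q \<in> F n; {p} \<turnstile> q\<rbrakk> \<Longrightarrow> {T p} \<turnstile> T q"
    and s_mono: "\<lbrakk>a \<in> F m; b \<in> F m; {a} \<turnstile> b\<rbrakk> \<Longrightarrow> {s a} \<turnstile> s b"
    and T_And: "T (And p q) = And (T p) (T q)"
    and T_Or: "T (Or p q) = Or (T p) (T q)"
    and s_bounds: "a \<in> F m \<Longrightarrow> {\<phi>} \<turnstile> s a" "a \<in> F m \<Longrightarrow> {s a} \<turnstile> \<psi>"
    and T_s: "a \<in> F m \<Longrightarrow> {T (s a)} \<turnstile> a" "a \<in> F m \<Longrightarrow> {a} \<turnstile> T (s a)"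
    and s_T: "\<lbrakk>p \<in> F n; {\<phi>} \<turnstile> p; {p} \<turnstile> \<psi>\<rbrakk> \<Longrightarrow> {s (T p)} \<turnstile> p"
      "\<lbrakk>p \<in> F n; {\<phi>} \<turnstile> p; {p} \<turnstile> \<psi>\<rbrakk> \<Longrightarrow> {p} \<turnstile> s (T p)"

lemma interval_retract_refl: "interval_retract n n Bot (Imp Bot Bot) id id"
  by unfold_locales (simp_all add: derives_invertible derives.Ax)

text \<open>The new interval is bounded by the images of the inner bounds. It lies inside the outer
  interval, where \<open>s\<close> inverts \<open>T\<close>, and \<open>T\<close> carries it into the inner one.\<close>

lemma interval_retract_trans:
  assumes "interval_retract n m \<phi> \<psi> T s" "interval_retract m k \<phi>' \<psi>' T' s'"
  shows "interval_retract n k (s \<phi>') (s \<psi>') (T' \<circ> T) (s \<circ> s')"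
proof -
  interpret A: interval_retract n m \<phi> \<psi> T s by fact
  interpret B: interval_retract m k \<phi>' \<psi>' T' s' by fact
  note closed = A.bounds B.bounds A.T_F A.s_F B.T_F B.s_F
  have equiv: "{(s \<circ> s') ((T' \<circ> T) p)} \<turnstile> p \<and> {p} \<turnstile> (s \<circ> s') ((T' \<circ> T) p)"
    if p: "p \<in> F n" "{s \<phi>'} \<turnstile> p" "{p} \<turnstile> s \<psi>'" for p
  proof -
    have "{\<phi>'} \<turnstile> T p"
      using A.T_s(2)[of \<phi>'] A.T_mono[of "s \<phi>'" p] p closed by (blast intro: derives_trans)
    moreover have "{T p} \<turnstile> \<psi>'"
      using A.T_s(1)[of \<psi>'] A.T_mono[of p "s \<psi>'"] p closed by (blast intro: derives_trans)
    ultimately have "{s' (T' (T p))} \<turnstile> T p" "{T p} \<turnstile> s' (T' (T p))"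
      using B.s_T p closed by blast+
    then have "{s (s' (T' (T p)))} \<turnstile> s (T p)" "{s (T p)} \<turnstile> s (s' (T' (T p)))"
      using p(1) by (simp_all add: A.s_mono A.T_F B.T_F B.s_F)
    moreover have "{\<phi>} \<turnstile> p" "{p} \<turnstile> \<psi>"
      using derives_trans[OF A.s_bounds(1) p(2)] derives_trans[OF p(3) A.s_bounds(2)] closed
      by blast+
    then have "{s (T p)} \<turnstile> p" "{p} \<turnstile> s (T p)"
      using A.s_T p by blast+
    ultimately show ?thesis
      using derives_trans by (metis comp_apply)
  qed
  show ?thesis
  proof
    fix a assume a: "a \<in> F k"
    show "{(T' \<circ> T) ((s \<circ> s') a)} \<turnstile> a"
      using B.T_s(1)[OF a] B.T_mono[OF _ _ A.T_s(1)[of "s' a"]] a closed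
      unfolding comp_apply by (blast intro: derives_trans)
    show "{a} \<turnstile> (T' \<circ> T) ((s \<circ> s') a)"
      using B.T_s(2)[OF a] B.T_mono[OF _ _ A.T_s(2)[of "s' a"]] a closed
      unfolding comp_apply by (blast intro: derives_trans)
  qed (use equiv in \<open>auto simp: closed A.T_mono A.s_mono B.T_mono B.s_mono A.T_And A.T_Or
    B.T_And B.T_Or B.s_bounds\<close>)
qed

context interval_retract
begin

definition T_class :: "nat form set \<Rightarrow> nat form set" where
  "T_class A = (\<Union>p\<in>A. int_equiv m `` {T p})"

lemma T_class_eq: "p \<in> F n \<Longrightarrow> T_class (int_equiv n `` {p}) = int_equiv m `` {T p}"
  unfolding T_class_def
proof (rule UN_equiv_class[OF equiv_int_equiv])
  show "(\<lambda>p. int_equiv m `` {T p}) respects int_equiv n"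
    by (rule congruentI, rule equiv_class_eq[OF equiv_int_equiv])
      (simp add: int_equiv_def T_F T_mono)
qed

lemma class_eq: "a \<in> F k \<Longrightarrow> b \<in> F k \<Longrightarrow> {a} \<turnstile> b \<Longrightarrow> {b} \<turnstile> a
    \<Longrightarrow> int_equiv k `` {a} = int_equiv k `` {b}"
  by (rule equiv_class_eq[OF equiv_int_equiv]) (simp add: int_equiv_def)

lemma T_class_closed: "A \<in> carrier (H n) \<Longrightarrow> T_class A \<in> carrier (H m)"
  by (erule H_cases) (simp add: T_class_eq T_F class_in_H)

lemma T_class_lattice_hom: "T_class \<in> lattice_hom (H n) (H m)"
  by (auto simp: lattice_hom_def meet_pres_def join_pres_def T_class_closed lattice_H elim!: H_cases)
    (simp_all add: meet_H join_H T_class_eq T_F T_And T_Or)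

lemma interval_cases:
  assumes "A \<in> \<lbrace>int_equiv n `` {\<phi>}..int_equiv n `` {\<psi>}\<rbrace>\<^bsub>H n\<^esub>"
  obtains p where "p \<in> F n" "A = int_equiv n `` {p}" "{\<phi>} \<turnstile> p" "{p} \<turnstile> \<psi>"
  using assms by (auto simp: at_least_at_most_def le_H bounds elim!: H_cases)

lemma s_class_in_interval:
  "a \<in> F m \<Longrightarrow> int_equiv n `` {s a} \<in> \<lbrace>int_equiv n `` {\<phi>}..int_equiv n `` {\<psi>}\<rbrace>\<^bsub>H n\<^esub>"
  by (simp add: at_least_at_most_def le_H bounds s_F class_in_H s_bounds)

lemma T_class_s: "a \<in> F m \<Longrightarrow> T_class (int_equiv n `` {s a}) = int_equiv m `` {a}"
  unfolding T_class_eq[OF s_F] by (rule class_eq) (simp_all add: T_F s_F T_s)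

lemma T_class_surj: "T_class ` carrier (H n) = carrier (H m)"
proof
  show "carrier (H m) \<subseteq> T_class ` carrier (H n)"
    by (auto elim!: H_cases intro: rev_image_eqI[OF class_in_H[OF s_F]] simp: T_class_s)
qed (auto simp: T_class_closed)

lemma T_class_lattice_iso:
  "T_class \<in> lattice_iso (interval (H n) (int_equiv n `` {\<phi>}) (int_equiv n `` {\<psi>})) (H m)"
proof -
  let ?a = "int_equiv n `` {\<phi>}" and ?b = "int_equiv n `` {\<psi>}"
  interpret lattice "H n" by (rule lattice_H)
  have closed: "?a \<in> carrier (H n)" "?b \<in> carrier (H n)"
    by (simp_all add: class_in_H bounds)
  have sub: "A \<in> \<lbrace>?a..?b\<rbrace>\<^bsub>H n\<^esub> \<Longrightarrow> A \<in> carrier (H n)" for A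
    by (simp add: at_least_at_most_def)
  have "bij_betw T_class \<lbrace>?a..?b\<rbrace>\<^bsub>H n\<^esub> (carrier (H m))"
  proof (rule bij_betw_imageI)
    show "inj_on T_class \<lbrace>?a..?b\<rbrace>\<^bsub>H n\<^esub>"
    proof (rule inj_onI, elim interval_cases)
      fix A B p q
      assume pq: "p \<in> F n" "A = int_equiv n `` {p}" "{\<phi>} \<turnstile> p" "{p} \<turnstile> \<psi>"
        "q \<in> F n" "B = int_equiv n `` {q}" "{\<phi>} \<turnstile> q" "{q} \<turnstile> \<psi>"
        and "T_class A = T_class B"
      then have "(T p, T q) \<in> int_equiv m"
        by (simp add: T_class_eq T_F eq_equiv_class[OF _ equiv_int_equiv])
      then have "{s (T p)} \<turnstile> s (T q)" "{s (T q)} \<turnstile> s (T p)"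
        by (simp_all add: int_equiv_def s_mono)
      then have "{p} \<turnstile> q" "{q} \<turnstile> p"
        using pq s_T by (blast intro: derives_trans)+
      then have "int_equiv n `` {p} = int_equiv n `` {q}"
        by (rule class_eq[OF pq(1) pq(5)])
      then show "A = B"
        by (simp only: pq(2,6))
    qed
    show "T_class ` \<lbrace>?a..?b\<rbrace>\<^bsub>H n\<^esub> = carrier (H m)"
    proof
      show "carrier (H m) \<subseteq> T_class ` \<lbrace>?a..?b\<rbrace>\<^bsub>H n\<^esub>"
        by (auto elim!: H_cases intro: rev_image_eqI[OF s_class_in_interval] simp: T_class_s)
    qed (auto simp: T_class_closed sub)
  qed
  moreover have "T_class \<in> lattice_hom (interval (H n) ?a ?b) (H m)"
    using T_class_lattice_hom sub interval_meet_join[OF lattice_H closed]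
      lattice_interval[OF lattice_H closed]
    by (auto simp: lattice_hom_def meet_pres_def join_pres_def)
  ultimately show ?thesis
    by (simp add: lattice_iso_def)
qed

end

section \<open>Forgetting the last variable\<close>

primrec falsify :: "'a \<Rightarrow> 'a form \<Rightarrow> 'a form" where
  "falsify k Bot = Bot"
| "falsify k (Var i) = (if i = k then Bot else Var i)"
| "falsify k (And p q) = And (falsify k p) (falsify k q)"
| "falsify k (Or p q) = Or (falsify k p) (falsify k q)"
| "falsify k (Imp p q) = Imp (falsify k p) (falsify k q)"

lemma falsify_derives: "\<Gamma> \<turnstile> p \<Longrightarrow> falsify k ` \<Gamma> \<turnstile> falsify k p"
  by (induction rule: derives.induct) (auto intro: derives.intros)

lemma falsify_F: "p \<in> F (Suc n) \<Longrightarrow> falsify (Suc n) p \<in> F n"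
  by (induction p) (auto simp: le_Suc_eq)

lemma falsify_idle: "p \<in> F n \<Longrightarrow> falsify (Suc n) p = p"
  by (induction p) auto

text \<open>Under a hypothesis refuting the variable, replacing it by \<open>Bot\<close> is replacement of
  equivalents.\<close>

lemma falsify_equiv: "\<Gamma> \<turnstile> Neg (Var k) \<Longrightarrow> equiv_under \<Gamma> p (falsify k p)"
proof (induction p)
  case (Var x)
  then show ?case
    by (auto simp: equiv_under_refl) (simp add: equiv_under_def derives_invertible)
qed (simp_all add: equiv_under_refl equiv_under_And equiv_under_Or equiv_under_Imp)

lemma interval_retract_pred:
  "interval_retract (Suc n) n Bot (Neg (Var (Suc n))) (falsify (Suc n))
    (\<lambda>a. And a (Neg (Var (Suc n))))"
proof
  let ?k = "Var (Suc n)"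
  fix p :: "nat form" assume p: "{p} \<turnstile> Neg ?k"
  show "{And (falsify (Suc n) p) (Neg ?k)} \<turnstile> p"
    using falsify_equiv[of "{Neg ?k}" "Suc n" p]
    by (simp add: equiv_under_def derives_from_And derives.Ax)
  show "{p} \<turnstile> And (falsify (Suc n) p) (Neg ?k)"
    using falsify_equiv[OF p, of p] p by (simp add: equiv_under_def derives_And_iff)
next
  fix a b assume "a \<in> F n" "b \<in> F n" "{a} \<turnstile> b"
  then show "{And a (Neg (Var (Suc n)))} \<turnstile> And b (Neg (Var (Suc n)))"
    by (auto simp: derives_from_And derives_And_iff derives.Ax intro: derives_mono)
next
  fix p q :: "nat form" assume "{p} \<turnstile> q"
  then show "{falsify (Suc n) p} \<turnstile> falsify (Suc n) q"
    using falsify_derives[of "{p}"] by simp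
next
  fix a assume "a \<in> F n"
  then show "And a (Neg (Var (Suc n))) \<in> F (Suc n)"
    by (auto simp: F_def)
next
  fix a assume "a \<in> F n"
  then show "{falsify (Suc n) (And a (Neg (Var (Suc n))))} \<turnstile> a"
    "{a} \<turnstile> falsify (Suc n) (And a (Neg (Var (Suc n))))"
    by (simp_all add: falsify_idle derives_And_iff derives_from_And derives_Imp_iff derives.Ax)
next
  fix a assume "a \<in> F n"
  show "{And a (Neg (Var (Suc n)))} \<turnstile> Neg (Var (Suc n))"
    unfolding derives_from_And by (rule derives.Ax) simp
qed (simp_all add: falsify_F derives_from_Bot)

section \<open>Trading four maximal worlds for an additional variable\<close>

text \<open>Truth values at a corner. All variables other than the first two are true there, so that the
  values they take at worlds below are unconstrained by persistence.\<close>

definition corner :: "bool \<Rightarrow> bool \<Rightarrow> nat \<Rightarrow> bool" where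
  "corner a b i = (if i = 1 then a else if i = 2 then b else True)"

text \<open>The condition, in the variables of the lower model, that a world does not see the given corner.
  For the corner with both values true it is \<open>Bot\<close>: that corner is always visible. This is what
  separates the worlds below, even one at which all variables are true, from the corners.\<close>

definition unseen :: "nat \<Rightarrow> bool \<Rightarrow> bool \<Rightarrow> nat form" where
  "unseen n a b = (if a then if b then Bot else Var 1 else if b then Var 2 else Var (Suc n))"

definition guard :: "nat \<Rightarrow> nat form \<Rightarrow> bool \<Rightarrow> bool \<Rightarrow> nat form" where
  "guard n p a b = (if holds (corner a b) p then Imp Bot Bot else unseen n a b)"

text \<open>Forcing in the enlarged model, expressed in the lower model. A world below forces \<open>Imp p q\<close> when
  the implication holds both at all later worlds of the lower model and at each visible corner;
  the guards express the second condition.\<close>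

primrec trace :: "nat \<Rightarrow> nat form \<Rightarrow> nat form" where
  "trace n Bot = Bot"
| "trace n (Var i) = (if i \<le> 2 then Bot else Var i)"
| "trace n (And p q) = And (trace n p) (trace n q)"
| "trace n (Or p q) = Or (trace n p) (trace n q)"
| "trace n (Imp p q) = And (Imp (trace n p) (trace n q))
    (And (And (guard n (Imp p q) True True) (guard n (Imp p q) True False))
         (And (guard n (Imp p q) False True) (guard n (Imp p q) False False)))"

lemma derives_guard_iff:
  "\<Gamma> \<turnstile> guard n p a b \<longleftrightarrow> (\<not> holds (corner a b) p \<longrightarrow> \<Gamma> \<turnstile> unseen n a b)"
  by (simp add: guard_def derives_invertible)

lemma derives_trace_Imp_iff:
  "\<Gamma> \<turnstile> trace n (Imp p q) \<longleftrightarrow> insert (trace n p) \<Gamma> \<turnstile> trace n q \<and>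
    (\<forall>a b. \<not> holds (corner a b) (Imp p q) \<longrightarrow> \<Gamma> \<turnstile> unseen n a b)"
  unfolding trace.simps derives_And_iff derives_guard_iff derives_Imp_iff all_bool_eq by blast

text \<open>Persistence along the edge from a world below to a corner: a formula false at a corner can be
  forced only by worlds that do not see this corner.\<close>

lemma trace_reflects_corner:
  "\<not> holds (corner a b) p \<Longrightarrow> insert (trace n p) \<Gamma> \<turnstile> unseen n a b"
proof (induction p)
  case (Var i)
  then show ?case by (auto simp: corner_def derives_from_Bot split: if_splits)
next
  case (And p q)
  then show ?case by (auto simp: derives_from_And intro: derives_weaken derives_weaken_under)
next
  case (Imp p q)
  have "insert (trace n (Imp p q)) \<Gamma> \<turnstile> trace n (Imp p q)"
    by (rule derives.Ax) blast
  then show ?case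
    using Imp.prems unfolding derives_trace_Imp_iff by blast
qed (auto simp: derives_from_Bot derives_from_Or)

text \<open>The corner with both values true is visible from everywhere.\<close>

lemma trace_refuted: "\<not> holds (corner True True) p \<Longrightarrow> insert (trace n p) \<Gamma> \<turnstile> Bot"
  using trace_reflects_corner[of True True] by (simp add: unseen_def)

text \<open>Soundness of the enlarged model. The case of implication introduction needs both preceding
  ingredients: if a corner violates the implication, then by two-valued soundness it violates a
  hypothesis, and by persistence that hypothesis excludes the corner from view.\<close>

lemma trace_derives: "\<Gamma> \<turnstile> p \<Longrightarrow> trace n ` \<Gamma> \<turnstile> trace n p"
proof (induction rule: derives.induct)
  case (ImpI p \<Gamma> q)
  have "trace n ` \<Gamma> \<turnstile> unseen n a b" if "\<not> holds (corner a b) (Imp p q)" for a b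
  proof -
    obtain r where r: "r \<in> \<Gamma>" "\<not> holds (corner a b) r"
      using derives_imp_holds[OF ImpI.hyps, of "corner a b"] \<open>\<not> holds _ (Imp p q)\<close> by auto
    then have "insert (trace n r) (trace n ` \<Gamma>) \<turnstile> unseen n a b"
      by (intro trace_reflects_corner)
    then show ?thesis
      using r by (simp add: insert_absorb)
  qed
  then show ?case
    using ImpI.IH by (simp only: derives_trace_Imp_iff image_insert) blast
next
  case (ImpE \<Gamma> p q)
  then show ?case
    unfolding derives_trace_Imp_iff by (blast intro: derives_cut)
next
  case (OrE \<Gamma> p q r)
  then show ?case by (auto intro: derives.OrE)
qed (auto intro: derives.intros)

lemma trace_F: "2 \<le> n \<Longrightarrow> p \<in> F n \<Longrightarrow> trace n p \<in> F (Suc n)"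
  by (induction p) (auto simp: guard_def unseen_def)

text \<open>The lower end of the interval: \<open>x\<close> and \<open>y\<close> have classical values and the other variables
  are true.\<close>

definition decided :: "nat \<Rightarrow> nat form" where
  "decided n = foldr And (map Var [3..<Suc n])
    (And (Or (Var 1) (Neg (Var 1))) (Or (Var 2) (Neg (Var 2))))"

text \<open>The upper end of the interval. A world at which \<open>x\<close> or \<open>y\<close> is true, or from which no world with
  both true can be seen, must satisfy \<open>decided n\<close>. In particular every world where \<open>x\<close> and \<open>y\<close>
  have classical values behaves like a corner (\<open>framed_cell\<close>).\<close>

definition framed :: "nat \<Rightarrow> nat form" where
  "framed n = And (Imp (Or (Var 1) (Var 2)) (decided n))
    (Imp (Neg (And (Var 1) (Var 2))) (decided n))"

definition literal :: "bool \<Rightarrow> nat \<Rightarrow> nat form" where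
  "literal a i = (if a then Var i else Neg (Var i))"

text \<open>The formula that singles out a corner among the four.\<close>

definition cell :: "bool \<Rightarrow> bool \<Rightarrow> nat form" where
  "cell a b = And (literal a 1) (literal b 2)"

lemma decided_F: "2 \<le> n \<Longrightarrow> decided n \<in> F n"
proof -
  have "foldr And ps q \<in> F n \<longleftrightarrow> set ps \<subseteq> F n \<and> q \<in> F n" for ps q
    by (induction ps) auto
  then show "2 \<le> n \<Longrightarrow> decided n \<in> F n"
    by (auto simp: decided_def)
qed

lemma framed_F: "2 \<le> n \<Longrightarrow> framed n \<in> F n"
  by (simp add: framed_def decided_F)

lemma cell_F: "2 \<le> n \<Longrightarrow> cell a b \<in> F n"
  by (simp add: cell_def literal_def)

lemma derives_decided_iff:
  "\<Gamma> \<turnstile> decided n \<longleftrightarrow> (\<forall>i\<in>{3..n}. \<Gamma> \<turnstile> Var i) \<and>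
    \<Gamma> \<turnstile> Or (Var 1) (Neg (Var 1)) \<and> \<Gamma> \<turnstile> Or (Var 2) (Neg (Var 2))"
  by (auto simp: decided_def derives_conj_iff derives_And_iff)

lemma holds_decided: "holds (corner a b) (decided n)"
proof -
  have "holds v (foldr And ps q) \<longleftrightarrow> (\<forall>p\<in>set ps. holds v p) \<and> holds v q" for v :: "nat \<Rightarrow> bool" and ps q
    by (induction ps) auto
  then show ?thesis
    by (auto simp: decided_def corner_def)
qed

lemma holds_cell_iff: "holds (corner a b) (cell a' b') \<longleftrightarrow> a = a' \<and> b = b'"
  by (auto simp: cell_def literal_def corner_def)

text \<open>Below \<open>decided n\<close>, a derivation may distinguish the four corners.\<close>

lemma decided_cases:
  assumes "\<Gamma> \<turnstile> decided n" and cell: "\<And>a b. insert (cell a b) \<Gamma> \<turnstile> r"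
  shows "\<Gamma> \<turnstile> r"
proof -
  have lit: "\<Delta> \<turnstile> r" if "\<Delta> \<turnstile> Or (Var i) (Neg (Var i))" "\<And>a. insert (literal a i) \<Delta> \<turnstile> r" for \<Delta> i r
    using derives.OrE[OF that(1)] that(2)[of True] that(2)[of False] by (simp add: literal_def)
  show ?thesis
  proof (rule lit[of _ 1], goal_cases)
    case (2 a)
    show ?case
    proof (rule lit[of _ 2], goal_cases)
      case (2 b)
      then show ?case
        using cell[of a b] by (simp add: cell_def derives_from_And insert_commute)
    qed (use assms(1) in \<open>auto simp: derives_decided_iff intro: derives_weaken\<close>)
  qed (use assms(1) in \<open>simp add: derives_decided_iff\<close>)
qed

text \<open>Once a corner is singled out all variables are decided, and with them every formula.\<close>

lemma cell_decides:
  assumes "\<Gamma> \<turnstile> decided n" "\<Gamma> \<turnstile> cell a b" "p \<in> F n"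
  shows "(holds (corner a b) p \<longrightarrow> \<Gamma> \<turnstile> p) \<and> (\<not> holds (corner a b) p \<longrightarrow> \<Gamma> \<turnstile> Neg p)"
  using assms(3)
proof (induction p)
  case Bot
  then show ?case by (simp add: derives_invertible)
next
  case (Var i)
  consider "i = 1" | "i = 2" | "i \<in> {3..n}"
    using Var by fastforce
  then show ?case
    using assms(1,2)
    by cases (auto simp: cell_def literal_def corner_def derives_decided_iff derives_And_iff)
next
  case (And p q)
  then show ?case
    by (auto simp: derives_invertible intro: derives_weaken derives_weaken_under)
next
  case (Or p q)
  then show ?case
    by (auto simp: derives_invertible intro: derives.OrI1 derives.OrI2)
next
  case (Imp p q)
  then have IH: "holds (corner a b) p \<Longrightarrow> \<Gamma> \<turnstile> p" "\<not> holds (corner a b) p \<Longrightarrow> insert p \<Gamma> \<turnstile> Bot"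
    "holds (corner a b) q \<Longrightarrow> \<Gamma> \<turnstile> q" "\<not> holds (corner a b) q \<Longrightarrow> \<Gamma> \<turnstile> Neg q"
    by (simp_all add: derives_Imp_iff)
  show ?case
  proof (intro conjI impI)
    assume "holds (corner a b) (Imp p q)"
    then show "\<Gamma> \<turnstile> Imp p q"
      using IH by (auto simp: derives_Imp_iff intro: derives_weaken derives.BotE)
  next
    assume "\<not> holds (corner a b) (Imp p q)"
    then have "insert (Imp p q) \<Gamma> \<turnstile> p" "insert (Imp p q) \<Gamma> \<turnstile> Neg q"
      using IH by (auto intro: derives_weaken)
    then show "\<Gamma> \<turnstile> Neg (Imp p q)"
      unfolding derives_Imp_iff[of \<Gamma>]
      by (meson derives.Ax derives.ImpE insertI1)
  qed
qed

lemma framed_cell: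
  assumes "\<Gamma> \<turnstile> framed n" "\<Gamma> \<turnstile> cell a b"
  shows "\<Gamma> \<turnstile> decided n"
proof (cases "a \<or> b")
  case True
  then have "\<Gamma> \<turnstile> Or (Var 1) (Var 2)"
    using assms(2)
    by (auto simp: cell_def literal_def derives_And_iff intro: derives.OrI1 derives.OrI2)
  then show ?thesis
    using assms(1) unfolding framed_def derives_And_iff by (blast intro: derives.ImpE)
next
  case False
  then have "\<Gamma> \<turnstile> Neg (And (Var 1) (Var 2))"
    using assms(2)
    by (auto simp: cell_def literal_def derives_invertible intro: derives_mono)
  then show ?thesis
    using assms(1) unfolding framed_def derives_And_iff by (blast intro: derives.ImpE)
qed

text \<open>The encoding of the lower model's variables. It reads \<open>Bot\<close> as the lower end of the interval,
  and for the same reason each variable receives the disjunct \<open>decided n\<close>. The first, the second and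
  the last variable say that a corner is not seen, in agreement with \<open>unseen\<close>.\<close>

primrec realize :: "nat \<Rightarrow> nat form \<Rightarrow> nat form" where
  "realize n Bot = decided n"
| "realize n (Var i) =
    Or (if i = 1 then Neg (cell True False)
        else if i = 2 then Neg (cell False True)
        else if i = Suc n then Neg (cell False False)
        else Var i) (decided n)"
| "realize n (And p q) = And (realize n p) (realize n q)"
| "realize n (Or p q) = Or (realize n p) (realize n q)"
| "realize n (Imp p q) = Imp (realize n p) (realize n q)"

lemma realize_F: "2 \<le> n \<Longrightarrow> p \<in> F (Suc n) \<Longrightarrow> realize n p \<in> F n"
  by (induction p) (auto simp: decided_F cell_F)

lemma decided_realize: "\<Gamma> \<turnstile> decided n \<Longrightarrow> \<Gamma> \<turnstile> realize n p"
  by (induction p arbitrary: \<Gamma>)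
    (auto simp: derives_And_iff derives_Imp_iff intro: derives.OrI1 derives.OrI2 derives_weaken)

text \<open>Since \<open>realize\<close> commutes with the connectives, only the rule for \<open>Bot\<close> needs an argument:
  every image lies above \<open>decided n\<close>.\<close>

lemma realize_derives: "\<Gamma> \<turnstile> p \<Longrightarrow> realize n ` \<Gamma> \<turnstile> realize n p"
proof (induction rule: derives.induct)
  case (BotE \<Gamma> p)
  then show ?case by (simp add: decided_realize)
qed (auto intro: derives.intros)

lemma holds_realize: "holds (corner a b) (realize n p)"
  by (induction p) (simp_all add: holds_decided)

text \<open>If a world below satisfied \<open>decided n\<close>, it would force \<open>x\<close> or \<open>Neg x\<close>. But \<open>x\<close> is false
  there and \<open>Neg x\<close> fails at the corner that every world sees.\<close>

lemma trace_decided: "insert (trace n (decided n)) \<Gamma> \<turnstile> Bot"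
proof -
  have "{decided n} \<turnstile> Or (Var 1) (Neg (Var 1))"
    using derives.Ax[of "decided n" "{decided n}"] by (simp add: derives_decided_iff)
  then have "{trace n (decided n)} \<turnstile> Or Bot (trace n (Neg (Var 1)))"
    using trace_derives[of "{decided n}" "Or (Var 1) (Neg (Var 1))" n] by simp
  moreover have "insert (trace n (Neg (Var 1))) \<Gamma> \<turnstile> Bot" for \<Gamma>
    by (rule trace_refuted) (simp add: corner_def)
  ultimately have "{trace n (decided n)} \<turnstile> Bot"
    by (blast intro: derives.OrE derives_from_Bot)
  then show ?thesis
    by (rule derives_mono) blast
qed

lemma trace_cell: "insert (trace n (cell a b)) \<Gamma> \<turnstile> Bot"
proof -
  have "insert (trace n (literal a 1)) \<Delta> \<turnstile> Bot" for \<Delta>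
  proof (cases a)
    case True
    then show ?thesis by (simp add: literal_def derives_from_Bot)
  next
    case False
    then show ?thesis by (intro trace_refuted) (simp add: literal_def corner_def)
  qed
  then show ?thesis
    by (simp add: cell_def derives_from_And)
qed

text \<open>No world below satisfies a \<open>cell\<close>, and each corner satisfies only its own. Thus a negated cell
  is forced exactly where this corner is out of sight.\<close>

lemma trace_Neg_cell: "equiv_under \<Gamma> (trace n (Neg (cell a b))) (unseen n a b)"
  unfolding equiv_under_def
proof
  show "insert (trace n (Neg (cell a b))) \<Gamma> \<turnstile> unseen n a b"
    by (rule trace_reflects_corner) (simp add: holds_cell_iff)
  show "insert (unseen n a b) \<Gamma> \<turnstile> trace n (Neg (cell a b))"
    unfolding derives_trace_Imp_iff
    by (auto simp: trace_cell holds_cell_iff derives.Ax)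
qed

text \<open>Reading an encoding back gives the original formula. For implications the guards are void,
  as all encodings are true at all corners.\<close>

lemma trace_realize:
  assumes "2 \<le> n"
  shows "p \<in> F (Suc n) \<Longrightarrow> equiv_under \<Gamma> (trace n (realize n p)) p"
proof (induction p)
  case Bot
  then show ?case
    by (simp add: equiv_under_def trace_decided derives_from_Bot)
next
  case (Var i)
  have *: "equiv_under \<Gamma> (trace n (Or p (decided n))) q" if "equiv_under \<Gamma> (trace n p) q" for p q
    using that
    by (auto simp: equiv_under_def derives_from_Or
        intro: derives.OrI1 derives.BotE[OF trace_decided])
  consider "i = 1" | "i = 2" | "i = Suc n" | "i \<in> {3..n}"
    using Var by fastforce
  then show ?case
  proof cases
    case 1
    then show ?thesis
      using *[OF trace_Neg_cell[of \<Gamma> n True False]] by (simp add: unseen_def)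
  next
    case 2
    then show ?thesis
      using *[OF trace_Neg_cell[of \<Gamma> n False True]] by (simp add: unseen_def)
  next
    case 3
    then show ?thesis
      using *[OF trace_Neg_cell[of \<Gamma> n False False]] assms by (simp add: unseen_def)
  next
    case 4
    then show ?thesis
      using *[of "Var i" "Var i"] by (simp add: equiv_under_refl)
  qed
next
  case (Imp p q)
  have "\<Delta> \<turnstile> trace n (realize n (Imp p q)) \<longleftrightarrow>
      \<Delta> \<turnstile> Imp (trace n (realize n p)) (trace n (realize n q))" for \<Delta>
    by (simp only: realize.simps derives_trace_Imp_iff holds.simps holds_realize derives_Imp_iff)
      simp
  moreover have "equiv_under \<Gamma> (Imp (trace n (realize n p)) (trace n (realize n q))) (Imp p q)"
    using Imp by (simp add: equiv_under_Imp)
  ultimately show ?case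
    unfolding equiv_under_def
    by (meson derives.Ax derives_mp insertI1 subset_insertI)
qed (simp_all add: equiv_under_And equiv_under_Or)

text \<open>Neither premise of \<open>framed n\<close> is forced at a world below, and its conclusion holds at the
  corners.\<close>

lemma trace_framed: "\<Gamma> \<turnstile> trace n (framed n)"
proof -
  have imp: "\<Gamma> \<turnstile> trace n (Imp p (decided n))" if "\<And>\<Delta>. insert (trace n p) \<Delta> \<turnstile> Bot" for p
    unfolding derives_trace_Imp_iff using that by (simp add: holds_decided derives.BotE)
  have "insert (trace n (Or (Var 1) (Var 2))) \<Delta> \<turnstile> Bot" for \<Delta>
    by (simp add: derives_from_Or derives_from_Bot)
  moreover have "insert (trace n (Neg (And (Var 1) (Var 2)))) \<Delta> \<turnstile> Bot" for \<Delta>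
    by (rule trace_refuted) (simp add: corner_def)
  ultimately show ?thesis
    unfolding framed_def trace.simps(3) derives_And_iff by (blast intro: imp)
qed

text \<open>For the corner with both values true this says that \<open>framed n\<close> does not allow it to be out
  of sight, except above \<open>decided n\<close>.\<close>

lemma realize_unseen:
  assumes "2 \<le> n" "\<Gamma> \<turnstile> framed n"
  shows "\<Gamma> \<turnstile> realize n (unseen n a b) \<longleftrightarrow> \<Gamma> \<turnstile> Or (Neg (cell a b)) (decided n)"
proof (cases "a \<and> b")
  case True
  have "insert (Neg (cell True True)) \<Gamma> \<turnstile> decided n"
  proof (rule derives.ImpE)
    show "insert (Neg (cell True True)) \<Gamma> \<turnstile> Imp (Neg (And (Var 1) (Var 2))) (decided n)"
      using assms(2) by (auto simp: framed_def derives_And_iff intro: derives_weaken)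
  qed (simp add: cell_def literal_def derives.Ax)
  then show ?thesis
    using True
    by (auto simp: unseen_def intro: derives.OrI2 derives.OrE derives.Ax)
next
  case False
  then show ?thesis
    using assms(1) by (auto simp: unseen_def)
qed

text \<open>This is where surjectivity onto the interval comes from: every formula in \<open>n\<close> variables agrees,
  between \<open>decided n\<close> and \<open>framed n\<close>, with the encoding of its trace. For an implication the point
  is that a world satisfying \<open>framed n\<close> but not \<open>decided n\<close> sees only worlds of this kind and
  corners, so that visibility of corners accounts for all that an implication can detect outside
  the lower model.\<close>

lemma realize_trace:
  assumes n: "2 \<le> n" and "\<Gamma> \<turnstile> framed n"
  shows "p \<in> F n \<Longrightarrow> equiv_under \<Gamma> (Or p (decided n)) (realize n (trace n p))"
  using assms(2)
proof (induction p arbitrary: \<Gamma>)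
  case Bot
  show ?case
    by (auto simp: equiv_under_def derives_invertible derives.Ax intro: derives.OrI2)
next
  case (Var i)
  show ?case
  proof (cases "i \<le> 2")
    case True
    then have "i = 1 \<or> i = 2"
      using Var.prems(1) by auto
    then have "insert (Var i) \<Gamma> \<turnstile> Or (Var 1) (Var 2)"
      by (auto intro: derives.OrI1 derives.OrI2 derives.Ax)
    moreover have "insert (Var i) \<Gamma> \<turnstile> Imp (Or (Var 1) (Var 2)) (decided n)"
      using Var.prems(2) by (auto simp: framed_def derives_And_iff intro: derives_weaken)
    ultimately have "insert (Var i) \<Gamma> \<turnstile> decided n"
      by (rule derives.ImpE[rotated])
    then show ?thesis
      using True
      by (auto simp: equiv_under_def derives_from_Or derives.Ax intro: derives.OrI2)
  next
    case False
    then show ?thesis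
      using Var.prems(1) by (simp add: equiv_under_refl)
  qed
next
  case (And p q)
  then have "equiv_under \<Gamma> (And (Or p (decided n)) (Or q (decided n)))
      (realize n (trace n (And p q)))"
    by (simp add: equiv_under_And)
  moreover have "\<Delta> \<turnstile> Or (And p q) (decided n) \<longleftrightarrow>
      \<Delta> \<turnstile> And (Or p (decided n)) (Or q (decided n))" for \<Delta>
  proof
    assume "\<Delta> \<turnstile> Or (And p q) (decided n)"
    then show "\<Delta> \<turnstile> And (Or p (decided n)) (Or q (decided n))"
      by (rule derives.OrE)
        (auto simp: derives_And_iff derives_from_And
          intro: derives.OrI1 derives.OrI2 derives.Ax)
  qed (simp add: derives_And_iff derives_Or_And)
  ultimately show ?case
    unfolding equiv_under_def
    by (meson derives.Ax derives_mp insertI1 subset_insertI)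
next
  case (Or p q)
  then have "equiv_under \<Gamma> (Or (Or p (decided n)) (Or q (decided n)))
      (realize n (trace n (Or p q)))"
    by (simp add: equiv_under_Or)
  moreover have "\<Delta> \<turnstile> Or (Or p q) (decided n) \<longleftrightarrow>
      \<Delta> \<turnstile> Or (Or p (decided n)) (Or q (decided n))" for \<Delta>
  proof
    assume "\<Delta> \<turnstile> Or (Or p q) (decided n)"
    then show "\<Delta> \<turnstile> Or (Or p (decided n)) (Or q (decided n))"
      by (rule derives.OrE)
        (auto simp: derives_from_Or intro: derives.OrI1 derives.OrI2 derives.Ax)
  next
    assume "\<Delta> \<turnstile> Or (Or p (decided n)) (Or q (decided n))"
    then show "\<Delta> \<turnstile> Or (Or p q) (decided n)"
      by (rule derives.OrE)
        (auto simp: derives_from_Or intro: derives.OrI1 derives.OrI2 derives.Ax)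
  qed
  ultimately show ?case
    unfolding equiv_under_def
    by (meson derives.Ax derives_mp insertI1 subset_insertI)
next
  case (Imp p q)
  let ?d = "decided n" and ?R = "\<lambda>r. realize n (trace n r)"
  have pq: "p \<in> F n" "q \<in> F n"
    using Imp.prems(1) by simp_all
  have to_R: "\<Delta> \<turnstile> Or r ?d \<Longrightarrow> \<Delta> \<turnstile> ?R r" and from_R: "\<Delta> \<turnstile> ?R r \<Longrightarrow> \<Delta> \<turnstile> Or r ?d"
    if "r = p \<or> r = q" "\<Delta> \<turnstile> framed n" for r \<Delta>
    using Imp.IH(1)[OF pq(1) that(2)] Imp.IH(2)[OF pq(2) that(2)] that(1)
    unfolding equiv_under_def by (blast intro: derives_cut)+
  have guards: "\<Delta> \<turnstile> realize n (guard n (Imp p q) a b) \<longleftrightarrow>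
      (holds (corner a b) (Imp p q) \<or> \<Delta> \<turnstile> Or (Neg (cell a b)) ?d)"
    if "\<Delta> \<turnstile> framed n" for \<Delta> a b
    using realize_unseen[OF n that]
    by (simp add: guard_def derives_Imp_iff derives.Ax del: holds.simps)
  have R_Imp: "\<Delta> \<turnstile> ?R (Imp p q) \<longleftrightarrow> insert (?R p) \<Delta> \<turnstile> ?R q \<and>
      (\<forall>a b. \<not> holds (corner a b) (Imp p q) \<longrightarrow> \<Delta> \<turnstile> Or (Neg (cell a b)) ?d)"
    if "\<Delta> \<turnstile> framed n" for \<Delta>
    unfolding trace.simps realize.simps derives_And_iff guards[OF that] derives_Imp_iff all_bool_eq
    by blast
  have "insert (Imp p q) \<Gamma> \<turnstile> ?R (Imp p q)"
  proof -
    let ?\<Delta> = "insert (Imp p q) \<Gamma>"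
    have framed: "insert r ?\<Delta> \<turnstile> framed n" "?\<Delta> \<turnstile> framed n" for r
      using Imp.prems(2) by (auto intro: derives_weaken)
    have "insert (?R p) ?\<Delta> \<turnstile> Or p ?d"
      by (rule from_R) (auto simp: framed derives.Ax)
    then have "insert (?R p) ?\<Delta> \<turnstile> Or q ?d"
    proof (rule derives.OrE)
      have "insert p (insert (?R p) ?\<Delta>) \<turnstile> q"
        by (rule derives.ImpE[of _ p]) (simp_all add: derives.Ax)
      then show "insert p (insert (?R p) ?\<Delta>) \<turnstile> Or q ?d"
        by (rule derives.OrI1)
    qed (simp add: derives.Ax derives.OrI2)
    then have "insert (?R p) ?\<Delta> \<turnstile> ?R q"
      by (rule to_R[rotated 2]) (simp_all add: framed)
    moreover have "?\<Delta> \<turnstile> Or (Neg (cell a b)) ?d" if *: "\<not> holds (corner a b) (Imp p q)" for a b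
    proof -
      let ?\<Theta> = "insert (cell a b) ?\<Delta>"
      have "?\<Theta> \<turnstile> cell a b"
        by (simp add: derives.Ax)
      moreover from framed(1) this have "?\<Theta> \<turnstile> ?d"
        by (rule framed_cell)
      ultimately have "?\<Theta> \<turnstile> Neg (Imp p q)"
        using cell_decides Imp.prems(1) * by blast
      then have "?\<Theta> \<turnstile> Bot"
        by (rule derives.ImpE) (simp add: derives.Ax)
      then show ?thesis
        by (intro derives.OrI1) (simp add: derives_Imp_iff)
    qed
    ultimately show ?thesis
      using R_Imp[OF framed(2)] by blast
  qed
  moreover have "insert ?d \<Gamma> \<turnstile> ?R (Imp p q)"
    by (rule decided_realize) (simp add: derives.Ax)
  moreover have "insert (?R (Imp p q)) \<Gamma> \<turnstile> Or (Imp p q) ?d"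
  proof -
    let ?\<Delta> = "insert (?R (Imp p q)) \<Gamma>"
    \<comment> \<open>The four guards yield four disjunctions with \<open>decided n\<close>. They are combined into a single one,
      so that all corners violating the implication can be excluded at once.\<close>
    define G where "G a b = (if holds (corner a b) (Imp p q) then Imp Bot Bot else Neg (cell a b))"
      for a b
    let ?G = "And (And (G True True) (G True False)) (And (G False True) (G False False))"
    have framed: "?\<Delta> \<turnstile> framed n"
      using Imp.prems(2) by (rule derives_weaken)
    have R: "?\<Delta> \<turnstile> ?R (Imp p q)"
      by (simp add: derives.Ax)
    then have "?\<Delta> \<turnstile> Or (G a b) ?d" for a b
      using R_Imp[OF framed] by (auto simp: G_def derives_invertible intro: derives.OrI1)
    then have "?\<Delta> \<turnstile> Or ?G ?d"
      by (intro derives_Or_And)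
    then show ?thesis
    proof (rule derives.OrE)
      let ?\<Theta> = "insert p (insert ?G ?\<Delta>)"
      have "?\<Theta> \<turnstile> ?G"
        by (simp add: derives.Ax)
      then have G: "?\<Theta> \<turnstile> G a b" for a b
        by (cases a; cases b) (simp_all add: derives_And_iff)
      have framed': "?\<Theta> \<turnstile> framed n"
        by (rule derives_mono[OF framed]) blast
      have "?\<Theta> \<turnstile> Or p ?d"
        by (rule derives.OrI1, rule derives.Ax) blast
      then have "?\<Theta> \<turnstile> ?R p"
        using to_R framed' by blast
      moreover have "?\<Theta> \<turnstile> Imp (?R p) (?R q)"
        using R R_Imp[OF framed] derives_Imp_iff by (blast intro: derives_weaken)
      ultimately have "?\<Theta> \<turnstile> ?R q"
        by (rule derives.ImpE[rotated])
      then have "?\<Theta> \<turnstile> Or q ?d"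
        using from_R framed' by blast
      \<comment> \<open>If only \<open>decided n\<close> is available in place of \<open>q\<close>, the world is a corner: either the implication
        is true there, or this corner has been excluded.\<close>
      then have "?\<Theta> \<turnstile> q"
      proof (rule derives.OrE)
        let ?\<Xi> = "insert ?d ?\<Theta>"
        have d: "?\<Xi> \<turnstile> ?d"
          by (simp add: derives.Ax)
        then show "?\<Xi> \<turnstile> q"
        proof (rule decided_cases)
          fix a b
          let ?\<Xi>' = "insert (cell a b) ?\<Xi>"
          have cell: "?\<Xi>' \<turnstile> cell a b"
            by (simp add: derives.Ax)
          show "?\<Xi>' \<turnstile> q"
          proof (cases "holds (corner a b) (Imp p q)")
            case True
            have "?\<Xi>' \<turnstile> Imp p q"
              using cell_decides[OF derives_weaken[OF d] cell Imp.prems(1)] True by blast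
            then show ?thesis
              by (rule derives.ImpE) (simp add: derives.Ax)
          next
            case False
            have "?\<Xi>' \<turnstile> Neg (cell a b)"
              using G[of a b] False unfolding G_def by (simp add: derives_weaken del: holds.simps)
            then show ?thesis
              using cell by (blast intro: derives.ImpE derives.BotE)
          qed
        qed
      qed (simp add: derives.Ax)
      then show "insert ?G ?\<Delta> \<turnstile> Or (Imp p q) ?d"
        by (intro derives.OrI1) (simp add: derives_Imp_iff)
    qed (simp add: derives.Ax derives.OrI2)
  qed
  ultimately show ?case
    by (simp only: equiv_under_def derives_from_Or)
qed

lemma interval_retract_Suc:
  assumes n: "2 \<le> n"
  shows "interval_retract n (Suc n) (decided n) (framed n) (trace n)
    (\<lambda>a. And (realize n a) (framed n))"
proof
  have decided_framed: "{decided n} \<turnstile> framed n"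
    by (simp add: framed_def derives_And_iff derives_Imp_iff derives.Ax)
  fix a
  show "{decided n} \<turnstile> And (realize n a) (framed n)"
    by (simp add: derives_And_iff decided_framed decided_realize derives.Ax)
  show "{And (realize n a) (framed n)} \<turnstile> framed n"
    by (simp add: derives_from_And derives.Ax)
  assume a: "a \<in> F (Suc n)"
  show "And (realize n a) (framed n) \<in> F n"
    using n a by (simp add: realize_F framed_F)
  show "{trace n (And (realize n a) (framed n))} \<turnstile> a"
    using trace_realize[OF n a, of "{trace n (framed n)}"]
    by (simp add: equiv_under_def derives_from_And)
  show "{a} \<turnstile> trace n (And (realize n a) (framed n))"
    using trace_realize[OF n a, of "{}"]
    by (simp add: equiv_under_def derives_And_iff trace_framed)
next
  fix a b :: "nat form" assume "{a} \<turnstile> b"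
  then have "{realize n a} \<turnstile> realize n b"
    using realize_derives[of "{a}" b n] by simp
  then show "{And (realize n a) (framed n)} \<turnstile> And (realize n b) (framed n)"
    by (auto simp: derives_from_And derives_And_iff derives.Ax intro: derives_mono)
next
  fix p :: "nat form" assume p: "p \<in> F n" "{decided n} \<turnstile> p" "{p} \<turnstile> framed n"
  have "{framed n} \<turnstile> framed n"
    by (simp add: derives.Ax)
  then have "{realize n (trace n p), framed n} \<turnstile> Or p (decided n)"
    using realize_trace[OF n _ p(1)] by (simp add: equiv_under_def)
  then have "{realize n (trace n p), framed n} \<turnstile> p"
    by (rule derives.OrE) (auto simp: derives.Ax intro: derives_mono[OF p(2)])
  then show "{And (realize n (trace n p)) (framed n)} \<turnstile> p"
    by (simp add: derives_from_And)
  have "{p} \<turnstile> realize n (trace n p)"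
    using realize_trace[OF n p(3) p(1)] by (simp add: equiv_under_def derives_from_Or)
  then show "{p} \<turnstile> And (realize n (trace n p)) (framed n)"
    using p(3) by (simp add: derives_And_iff)
next
  fix p q :: "nat form" assume "{p} \<turnstile> q"
  then show "{trace n p} \<turnstile> trace n q"
    using trace_derives[of "{p}"] by simp
qed (simp_all add: n trace_F decided_F framed_F)

section \<open>All numbers of variables\<close>

lemma interval_retract_exists:
  assumes "2 \<le> n"
  shows "\<exists>\<phi> \<psi> T s. interval_retract n m \<phi> \<psi> T s"
proof (cases "n \<le> m")
  case True
  then show ?thesis
  proof (induction rule: dec_induct)
    case (step k)
    then show ?case
      using interval_retract_trans[OF _ interval_retract_Suc[of k]] assms by fastforce
  qed (use interval_retract_refl in blast)
next
  case False
  then have "m \<le> n" by simp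
  then show ?thesis
  proof (induction rule: inc_induct)
    case (step k)
    then show ?case
      using interval_retract_trans[OF _ interval_retract_pred[of k]] by blast
  qed (use interval_retract_refl in blast)
qed

theorem theorem5:
  fixes n m :: nat
  assumes "n \<ge> 2" and "m \<ge> 1"
  shows "\<exists>\<phi>\<in>carrier (H n). \<exists>\<psi>\<in>carrier (H n).
    \<exists>f\<in>lattice_iso (interval (H n) \<phi> \<psi>) (H m).
      \<exists>g\<in>lattice_hom (H n) (H m).
        g ` carrier (H n) = carrier (H m) \<and> (\<forall>\<rho>\<in>\<lbrace>\<phi>..\<psi>\<rbrace>\<^bsub>H n\<^esub>. g \<rho> = f \<rho>)"
proof -
  obtain \<phi> \<psi> T s where "interval_retract n m \<phi> \<psi> T s"
    using interval_retract_exists[OF assms(1)] by blast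
  then interpret interval_retract n m \<phi> \<psi> T s .
  show ?thesis
    by (intro bexI[of _ "int_equiv n `` {\<phi>}"] bexI[of _ "int_equiv n `` {\<psi>}"] bexI[of _ T_class])
      (simp_all add: T_class_lattice_iso T_class_lattice_hom T_class_surj class_in_H bounds)
qed

end
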